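(* Consider a Markov decision process (MDP) with a safety objective, with finite state space $S$, state $s^*\in S$ to be avoided, finite nonempty action sets $A(s)$ and transition probabilities $p(\cdot\mid s,a)$. Suppose that for every initial state there is a strategy that weakly overtakes (in the sense of the safety objective) all other strategies at that initial state. Then there exists a stationary strategy that is strongly overtaking optimal (in the sense of the safety objective) at each initial state.
   Context: An MDP with a safety objective is given by a finite set $S$ of states with a distinguished state $s^*\in S$ that the decision maker wants to avoid, for each $s\in S$ a nonempty finite set $A(s)$ of actions, and for each $s\in S$, $a\in A(s)$ a probability distribution $p(\cdot\mid s,a)$ on $S$. Play runs over periods $1,2,3,\ldots$: it starts at period 1 in an initial state $s_1\in S\setminus\{s^*\}$ (initial states are always elements of $S\setminus\{s^*\}$); at each period $t$ the decision maker chooses an action $a_t\in A(s_t)$ and $s_{t+1}$ is drawn from $p(\cdot\mid s_t,a_t)$. A history at period $t$ is a sequence $(s_1,a_1,\ldots,s_{t-1},a_{t-1},s_t)$ with $a_i\in A(s_i)$ and $p(s_{i+1}\mid s_i,a_i)>0$ for all $i<t$; its final state is $s_t$. A strategy $\sigma$ assigns to each history $h$ a probability distribution $\sigma(h)$ on $A(s)$, where $s$ is the final state of $h$. It is stationary if $\sigma(h)$ depends only on the final state of $h$. $\mathbb{P}_{s\sigma}$ denotes the probability measure on infinite histories induced by initial state $s$ and strategy $\sigma$. Let $t^*$ be the first period at which the state is $s^*$ ($t^*=\infty$ if $s^*$ is never reached). For the safety objective, a strategy $\sigma$ weakly overtakes a strategy $\sigma'$ at the initial state $s$ if there is $T\in\mathbb{N}$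 such that $\mathbb{P}_{s\sigma}(t^*\leq t)\leq\mathbb{P}_{s\sigma'}(t^*\leq t)$ for all $t\geq T$, with strict inequality for infinitely many $t$. A strategy is strongly overtaking optimal at the initial state $s$ if no strategy weakly overtakes it at $s$. *)

theory Defs
  imports "HOL-Probability.Probability" "HOL-Library.Extended_Nat"
begin

text \<open>
  The finite state space is the type \<^typ>\<open>'s\<close>, and \<^typ>\<open>'a\<close> is a finite type containing all
  actions.  The values \<open>next_state M s a\<close> for actions \<open>a\<close> outside \<open>acts M s\<close> play no role.
\<close>

record ('s, 'a) safety_mdp =
  avoid :: 's
  acts :: "'s \<Rightarrow> 'a set"
  next_state :: "'s \<Rightarrow> 'a \<Rightarrow> 's pmf"

definition is_safety_mdp :: "('s::finite, 'a::finite) safety_mdp \<Rightarrow> bool" where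
  "is_safety_mdp M \<longleftrightarrow> (\<forall>s. acts M s \<noteq> {})"

text \<open>
  The sequence \<open>(s\<^sub>1, a\<^sub>1, \<dots>, s\<^sub>t\<^sub>-\<^sub>1, a\<^sub>t\<^sub>-\<^sub>1, s\<^sub>t)\<close> is encoded as
  \<open>([(s\<^sub>1, a\<^sub>1), \<dots>, (s\<^sub>t\<^sub>-\<^sub>1, a\<^sub>t\<^sub>-\<^sub>1)], s\<^sub>t)\<close>.
\<close>

type_synonym ('s, 'a) hist = "('s \<times> 'a) list \<times> 's"

definition state_at :: "('s, 'a) hist \<Rightarrow> nat \<Rightarrow> 's" where
  "state_at h i = (map fst (fst h) @ [snd h]) ! i"

definition is_history :: "('s, 'a) safety_mdp \<Rightarrow> ('s, 'a) hist \<Rightarrow> bool" where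
  "is_history M h \<longleftrightarrow>
     state_at h 0 \<noteq> avoid M \<and>
     (\<forall>i < length (fst h).
        snd (fst h ! i) \<in> acts M (state_at h i) \<and>
        pmf (next_state M (state_at h i) (snd (fst h ! i))) (state_at h (Suc i)) > 0)"

definition is_strategy :: "('s, 'a) safety_mdp \<Rightarrow> (('s, 'a) hist \<Rightarrow> 'a pmf) \<Rightarrow> bool" where
  "is_strategy M \<sigma> \<longleftrightarrow> (\<forall>h. is_history M h \<longrightarrow> set_pmf (\<sigma> h) \<subseteq> acts M (snd h))"

definition stationary :: "('s, 'a) safety_mdp \<Rightarrow> (('s, 'a) hist \<Rightarrow> 'a pmf) \<Rightarrow> bool" where
  "stationary M \<sigma> \<longleftrightarrow>
     (\<forall>h h'. is_history M h \<longrightarrow> is_history M h' \<longrightarrow> snd h = snd h' \<longrightarrow> \<sigma> h = \<sigma> h')"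

text \<open>
  An infinite history is a sequence \<open>\<omega> :: nat \<Rightarrow> 's \<times> 'a\<close> whose entry \<open>\<omega> n\<close> is the pair
  \<open>(s\<^sub>n\<^sub>+\<^sub>1, a\<^sub>n\<^sub>+\<^sub>1)\<close> of period \<open>n + 1\<close>.  The kernel below is the conditional law of \<open>\<omega> n\<close>
  given \<open>\<omega> 0, \<dots>, \<omega> (n - 1)\<close>.
\<close>

definition play_kernel ::
  "('s, 'a) safety_mdp \<Rightarrow> 's \<Rightarrow> (('s, 'a) hist \<Rightarrow> 'a pmf) \<Rightarrow> nat \<Rightarrow> (nat \<Rightarrow> 's \<times> 'a) \<Rightarrow> ('s \<times> 'a) pmf"
where
  "play_kernel M s \<sigma> n \<omega> =
     bind_pmf (case n of 0 \<Rightarrow> return_pmf s | Suc m \<Rightarrow> next_state M (fst (\<omega> m)) (snd (\<omega> m)))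
       (\<lambda>x. map_pmf (\<lambda>a. (x, a)) (\<sigma> (map \<omega> [0..<n], x)))"

definition play_measure ::
  "('s::finite, 'a::finite) safety_mdp \<Rightarrow> 's \<Rightarrow> (('s, 'a) hist \<Rightarrow> 'a pmf) \<Rightarrow> (nat \<Rightarrow> 's \<times> 'a) measure"
where
  "play_measure M s \<sigma> =
     projective_family.lim UNIV
       (Ionescu_Tulcea.CI (\<lambda>n \<omega>. measure_pmf (play_kernel M s \<sigma> n \<omega>)) (\<lambda>_. count_space UNIV))
       (\<lambda>_. count_space UNIV)"

lemma Ionescu_Tulcea_play_kernel:
  fixes M :: "('s::finite, 'a::finite) safety_mdp"
  shows "Ionescu_Tulcea (\<lambda>n \<omega>. measure_pmf (play_kernel M s \<sigma> n \<omega>)) (\<lambda>_. count_space UNIV)"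
proof
  fix i :: nat
  have "PiM {0..<i} (\<lambda>_. count_space (UNIV :: ('s \<times> 'a) set)) = count_space (PiE {0..<i} (\<lambda>_. UNIV))"
    by (rule count_space_PiM_finite) auto
  then show "(\<lambda>\<omega>. measure_pmf (play_kernel M s \<sigma> i \<omega>))
      \<in> measurable (PiM {0..<i} (\<lambda>_. count_space UNIV)) (subprob_algebra (count_space UNIV))"
    by (simp add: space_subprob_algebra measure_pmf.subprob_space_axioms)
qed

lemma sets_play_measure [measurable_cong]:
  "sets (play_measure M s \<sigma>) = sets (PiM UNIV (\<lambda>_. count_space UNIV))"
proof -
  interpret Ionescu_Tulcea "\<lambda>n \<omega>. measure_pmf (play_kernel M s \<sigma> n \<omega>)" "\<lambda>_. count_space UNIV"
    by (rule Ionescu_Tulcea_play_kernel)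
  show ?thesis unfolding play_measure_def by (rule PF.sets_lim)
qed

lemma distr_play_measure:
  assumes "finite J"
  shows "distr (play_measure M s \<sigma>) (PiM J (\<lambda>_. count_space UNIV)) (\<lambda>\<omega>. restrict \<omega> J) =
    Ionescu_Tulcea.CI (\<lambda>n \<omega>. measure_pmf (play_kernel M s \<sigma> n \<omega>)) (\<lambda>_. count_space UNIV) J"
proof -
  interpret Ionescu_Tulcea "\<lambda>n \<omega>. measure_pmf (play_kernel M s \<sigma> n \<omega>)" "\<lambda>_. count_space UNIV"
    by (rule Ionescu_Tulcea_play_kernel)
  show ?thesis unfolding play_measure_def by (rule distr_lim[OF assms])
qed

lemma prob_space_play_measure: "prob_space (play_measure M s \<sigma>)"
proof -
  interpret Ionescu_Tulcea "\<lambda>n \<omega>. measure_pmf (play_kernel M s \<sigma> n \<omega>)" "\<lambda>_. count_space UNIV"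
    by (rule Ionescu_Tulcea_play_kernel)
  have "prob_space (CI {})" by (rule PF.prob_space_P) auto
  then have "prob_space (distr (play_measure M s \<sigma>) (PiM {} (\<lambda>_. count_space UNIV)) (\<lambda>\<omega>. restrict \<omega> {}))"
    by (simp only: distr_play_measure[OF finite.emptyI])
  moreover have "(\<lambda>\<omega>. restrict \<omega> {}) \<in> measurable (play_measure M s \<sigma>) (PiM {} (\<lambda>_. count_space UNIV))"
    by (simp add: measurable_cong_sets[OF sets_play_measure refl])
  ultimately show ?thesis by (rule prob_space_distrD[rotated])
qed

text \<open>Periods are numbered from 1, and \<open>Inf {} = \<infinity>\<close> in \<^typ>\<open>enat\<close>.\<close>

definition hit_time :: "('s, 'a) safety_mdp \<Rightarrow> (nat \<Rightarrow> 's \<times> 'a) \<Rightarrow> enat" where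
  "hit_time M \<omega> = Inf {enat (Suc n) |n. fst (\<omega> n) = avoid M}"

definition hit_prob ::
  "('s::finite, 'a::finite) safety_mdp \<Rightarrow> 's \<Rightarrow> (('s, 'a) hist \<Rightarrow> 'a pmf) \<Rightarrow> nat \<Rightarrow> real" where
  "hit_prob M s \<sigma> t =
     measure (play_measure M s \<sigma>) {\<omega> \<in> space (play_measure M s \<sigma>). hit_time M \<omega> \<le> enat t}"

lemma hit_time_le_iff: "hit_time M \<omega> \<le> enat t \<longleftrightarrow> (\<exists>n<t. fst (\<omega> n) = avoid M)"
proof
  assume le: "hit_time M \<omega> \<le> enat t"
  let ?H = "{enat (Suc n) |n. fst (\<omega> n) = avoid M}"
  have ne: "?H \<noteq> {}"
  proof
    assume "?H = {}"
    then have "hit_time M \<omega> = \<infinity>" unfolding hit_time_def by (simp only: Inf_enat_def simp_thms if_True)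
    with le show False by simp
  qed
  then obtain x where "x \<in> ?H" by blast
  then have "Inf ?H \<in> ?H" unfolding Inf_enat_def using ne by (simp only: if_False) (rule LeastI)
  then obtain n where "Inf ?H = enat (Suc n)" "fst (\<omega> n) = avoid M" by blast
  then show "\<exists>n<t. fst (\<omega> n) = avoid M"
    using le unfolding hit_time_def by (intro exI[of _ n]) auto
next
  assume "\<exists>n<t. fst (\<omega> n) = avoid M"
  then obtain n where "n < t" "fst (\<omega> n) = avoid M" by blast
  then have "hit_time M \<omega> \<le> enat (Suc n)" unfolding hit_time_def by (intro Inf_lower) auto
  also have "\<dots> \<le> enat t" using \<open>n < t\<close> by simp
  finally show "hit_time M \<omega> \<le> enat t" .
qed

lemma sets_hit_event:
  "{\<omega> \<in> space (play_measure M s \<sigma>). hit_time M \<omega> \<le> enat t} \<in> sets (play_measure M s \<sigma>)"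
proof -
  have "(\<lambda>\<omega>. \<omega> n) \<in> measurable (play_measure M s \<sigma>) (count_space UNIV)" for n
    by (simp add: measurable_cong_sets[OF sets_play_measure refl] measurable_component_singleton)
  then have "{\<omega> \<in> space (play_measure M s \<sigma>). fst (\<omega> n) = avoid M} \<in> sets (play_measure M s \<sigma>)" for n
    using measurable_sets[of "\<lambda>\<omega>. \<omega> n" "play_measure M s \<sigma>" "count_space UNIV" "{x. fst x = avoid M}"]
    by (simp add: vimage_def Int_def conj_commute)
  then have "(\<Union>n<t. {\<omega> \<in> space (play_measure M s \<sigma>). fst (\<omega> n) = avoid M}) \<in> sets (play_measure M s \<sigma>)"
    by (intro sets.finite_UN) auto
  also have "(\<Union>n<t. {\<omega> \<in> space (play_measure M s \<sigma>). fst (\<omega> n) = avoid M}) =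
      {\<omega> \<in> space (play_measure M s \<sigma>). hit_time M \<omega> \<le> enat t}"
    by (auto simp: hit_time_le_iff)
  finally show ?thesis .
qed

definition weakly_overtakes ::
  "('s::finite, 'a::finite) safety_mdp \<Rightarrow> 's \<Rightarrow>
     (('s, 'a) hist \<Rightarrow> 'a pmf) \<Rightarrow> (('s, 'a) hist \<Rightarrow> 'a pmf) \<Rightarrow> bool" where
  "weakly_overtakes M s \<sigma> \<sigma>' \<longleftrightarrow>
     (\<exists>T. \<forall>t\<ge>T. hit_prob M s \<sigma> t \<le> hit_prob M s \<sigma>' t) \<and>
     infinite {t. hit_prob M s \<sigma> t < hit_prob M s \<sigma>' t}"

definition strongly_overtaking_optimal ::
  "('s::finite, 'a::finite) safety_mdp \<Rightarrow> 's \<Rightarrow> (('s, 'a) hist \<Rightarrow> 'a pmf) \<Rightarrow> bool" where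
  "strongly_overtaking_optimal M s \<sigma> \<longleftrightarrow> \<not> (\<exists>\<tau>. is_strategy M \<tau> \<and> weakly_overtakes M s \<tau> \<sigma>)"

text \<open>
  At initial state \<open>s\<close>, two strategies count as the same if they induce the same measure on
  infinite histories.  A strategy that differs from \<open>\<sigma>\<close> only at histories that have probability
  zero, or that start elsewhere, induces the same measure as \<open>\<sigma>\<close>, so it could never be weakly
  overtaken by \<open>\<sigma>\<close>.
\<close>

definition weakly_overtakes_all_others ::
  "('s::finite, 'a::finite) safety_mdp \<Rightarrow> 's \<Rightarrow> (('s, 'a) hist \<Rightarrow> 'a pmf) \<Rightarrow> bool" where
  "weakly_overtakes_all_others M s \<sigma> \<longleftrightarrow>
     (\<forall>\<sigma>'. is_strategy M \<sigma>' \<longrightarrow> play_measure M s \<sigma>' \<noteq> play_measure M s \<sigma> \<longrightarrow>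
        weakly_overtakes M s \<sigma> \<sigma>')"

end

theory Submission
  imports Defs
begin

text \<open>
  Modifying a strategy after a first step \<open>(s, a, y)\<close> changes the hitting probabilities by
  \<open>\<sigma>(a) p(y | s, a)\<close> times their change at \<open>y\<close>, one period earlier.  So if \<open>\<sigma>\<close> weakly overtakes all
  others at \<open>s\<close>, its continuation weakly overtakes all others at every \<open>y \<noteq> s\<^sup>*\<close> that it reaches.
  Weak overtaking is asymmetric, so such strategies are unique up to their law; hence, until \<open>s\<^sup>*\<close> is
  hit, \<open>\<sigma>\<close> must repeat at every state \<open>y\<close> the first move of the strategy given for \<open>y\<close>.
\<close>

section \<open>Laws of finite prefixes of a play\<close>

definition step_law ::
  "('s, 'a) safety_mdp \<Rightarrow> 's \<Rightarrow> (('s, 'a) hist \<Rightarrow> 'a pmf) \<Rightarrow> ('s \<times> 'a) list \<Rightarrow> ('s \<times> 'a) pmf" where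
  "step_law M s \<sigma> l =
     bind_pmf (if l = [] then return_pmf s else next_state M (fst (last l)) (snd (last l)))
       (\<lambda>x. map_pmf (Pair x) (\<sigma> (l, x)))"

text \<open>Lists turn finite-horizon probabilities into computations with a \<open>pmf\<close>,
  away from the limit measure.\<close>

primrec play_law ::
  "('s, 'a) safety_mdp \<Rightarrow> 's \<Rightarrow> (('s, 'a) hist \<Rightarrow> 'a pmf) \<Rightarrow> nat \<Rightarrow> ('s \<times> 'a) list pmf" where
  "play_law M s \<sigma> 0 = return_pmf []"
| "play_law M s \<sigma> (Suc n) =
     bind_pmf (play_law M s \<sigma> n) (\<lambda>l. map_pmf (\<lambda>x. l @ [x]) (step_law M s \<sigma> l))"

text \<open>The behaviour of \<open>\<sigma>\<close> from period 2 on once the play has begun with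
  \<open>(s, a)\<close>, with periods renumbered from 1.\<close>

definition shift_strategy :: "(('s, 'a) hist \<Rightarrow> 'a pmf) \<Rightarrow> 's \<Rightarrow> 'a \<Rightarrow> ('s, 'a) hist \<Rightarrow> 'a pmf" where
  "shift_strategy \<sigma> s a = (\<lambda>(l, x). \<sigma> ((s, a) # l, x))"

declare play_law.simps(2) [simp del]

lemma play_kernel_eq_step_law: "play_kernel M s \<sigma> n \<omega> = step_law M s \<sigma> (map \<omega> [0..<n])"
  by (cases n) (auto simp: play_kernel_def step_law_def)

text \<open>Induction along the finite kernel compositions \<open>C 0 n\<close>, each of which
  appends one pair drawn from \<open>step_law\<close>; the marginals of the projective limit are
  given by these compositions.\<close>

lemma distr_play_measure_prefix:
  fixes M :: "('s::finite, 'a::finite) safety_mdp"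
  shows "distr (play_measure M s \<sigma>) (count_space UNIV) (\<lambda>\<omega>. map \<omega> [0..<n]) =
    measure_pmf (play_law M s \<sigma> n)"
proof -
  interpret Ionescu_Tulcea "\<lambda>n \<omega>. measure_pmf (play_kernel M s \<sigma> n \<omega>)" "\<lambda>_. count_space UNIV"
    by (rule Ionescu_Tulcea_play_kernel)
  let ?P = "\<lambda>n :: nat. PiM {0..<n} (\<lambda>_. count_space (UNIV :: ('s \<times> 'a) set))"
  let ?g = "\<lambda>n \<omega>. map \<omega> [0..<n] :: ('s \<times> 'a) list"
  let ?C = "\<lambda>n. C 0 n (\<lambda>_. undefined)"
  have P_eq: "?P n = count_space (PiE {0..<n} (\<lambda>_. UNIV))" for n
    by (rule count_space_PiM_finite) auto
  have g_meas: "?g n \<in> measurable (?P n) (count_space UNIV)" for n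
    by (simp add: P_eq)
  have sets_C': "sets (?C n) = sets (?P n)" for n
    using sets_C[of "\<lambda>_. undefined" 0 n] by (simp add: space_PiM)
  have C_ne: "space (?C n) \<noteq> {}" for n
    using prob_space.not_empty[OF prob_space_C[of "\<lambda>_. undefined" 0 n]] by (simp add: space_PiM)
  have "distr (?C n) (count_space UNIV) (?g n) = measure_pmf (play_law M s \<sigma> n)" for n
  proof (induction n)
    case 0
    show ?case
      by (simp add: space_PiM distr_return return_pmf.rep_eq)
  next
    case (Suc n)
    let ?q = "\<lambda>l. measure_pmf (map_pmf (\<lambda>x. l @ [x]) (step_law M s \<sigma> l))"
    have eP_meas: "eP n \<in> measurable (?C n) (subprob_algebra (?P (Suc n)))"
      using measurable_eP[of n] by (simp add: measurable_cong_sets[OF sets_C' refl])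
    have "distr (?C (Suc n)) (count_space UNIV) (?g (Suc n)) =
        ?C n \<bind> (\<lambda>\<omega>. distr (eP n \<omega>) (count_space UNIV) (?g (Suc n)))"
      using distr_bind[OF eP_meas C_ne g_meas] by simp
    also have "\<dots> = ?C n \<bind> (\<lambda>\<omega>. ?q (?g n \<omega>))"
    proof (rule bind_cong[OF refl])
      fix \<omega> assume "\<omega> \<in> space (?C n)"
      then have \<omega>: "\<omega> \<in> space (?P n)"
        using sets_eq_imp_space_eq[OF sets_C'] by blast
      have m: "fun_upd \<omega> n \<in> measurable (measure_pmf (play_kernel M s \<sigma> n \<omega>)) (?P (Suc n))"
        using \<omega> by (auto simp: P_eq space_PiM PiE_iff extensional_def)
      have "distr (eP n \<omega>) (count_space UNIV) (?g (Suc n)) =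
          distr (measure_pmf (play_kernel M s \<sigma> n \<omega>)) (count_space UNIV)
            (?g (Suc n) \<circ> fun_upd \<omega> n)"
        unfolding eP_def by (rule distr_distr[OF g_meas m])
      also have "?g (Suc n) \<circ> fun_upd \<omega> n = (\<lambda>x. ?g n \<omega> @ [x])"
        by auto
      finally show "distr (eP n \<omega>) (count_space UNIV) (?g (Suc n)) = ?q (?g n \<omega>)"
        by (simp add: play_kernel_eq_step_law map_pmf_rep_eq)
    qed
    also have "\<dots> = distr (?C n) (count_space UNIV) (?g n) \<bind> ?q"
      by (rule bind_distr[symmetric, where K = "count_space UNIV"])
        (auto simp: C_ne space_subprob_algebra measure_pmf.subprob_space_axioms
           measurable_cong_sets[OF sets_C' refl] intro: g_meas)
    also have "\<dots> = measure_pmf (play_law M s \<sigma> (Suc n))"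
      by (simp add: Suc.IH measure_pmf_bind play_law.simps(2))
    finally show ?case .
  qed
  note C_law = this
  \<comment> \<open>\<open>CI\<close> of an index set restricts \<open>C 0 m\<close> to that set,
    with \<open>m\<close> its \<open>up_to\<close>; here the composition needed is
    \<open>C 0 n\<close>.\<close>
  have up: "up_to {0..<n} = n"
    by (rule antisym) (use up_to_iff_Ico[of "{0..<n}"] in auto)
  have r: "(\<lambda>\<omega>. restrict \<omega> {0..<n}) \<in> measurable (?C n) (?P n)"
    "(\<lambda>\<omega>. restrict \<omega> {0..<n}) \<in> measurable (play_measure M s \<sigma>) (?P n)"
    by (auto simp: measurable_cong_sets[OF sets_C' refl]
        measurable_cong_sets[OF sets_play_measure refl] intro!: measurable_restrict_subset)
  have gr: "?g n \<circ> (\<lambda>\<omega>. restrict \<omega> {0..<n}) = ?g n"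
    by auto
  have "distr (play_measure M s \<sigma>) (count_space UNIV) (?g n) =
      distr (distr (play_measure M s \<sigma>) (?P n) (\<lambda>\<omega>. restrict \<omega> {0..<n})) (count_space UNIV) (?g n)"
    by (simp only: distr_distr[OF g_meas r(2)] gr)
  also have "\<dots> = distr (distr (?C n) (?P n) (\<lambda>\<omega>. restrict \<omega> {0..<n})) (count_space UNIV) (?g n)"
    by (subst distr_play_measure) (simp_all add: CI_def up)
  also have "\<dots> = measure_pmf (play_law M s \<sigma> n)"
    by (simp only: distr_distr[OF g_meas r(1)] gr C_law)
  finally show ?thesis .
qed

lemma play_law_eqI:
  fixes M :: "('s::finite, 'a::finite) safety_mdp"
  assumes "play_measure M s \<sigma> = play_measure M s \<tau>"
  shows "play_law M s \<sigma> n = play_law M s \<tau> n"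
  using distr_play_measure_prefix[of M s \<sigma> n] distr_play_measure_prefix[of M s \<tau> n] assms
  by (simp add: measure_pmf_inject)

text \<open>Entry \<open>n\<close> of a play belongs to period \<open>n + 1\<close>, so hitting by
  period \<open>t\<close> is decided by the first \<open>t\<close> entries.\<close>

lemma hit_prob_eq_play_law:
  fixes M :: "('s::finite, 'a::finite) safety_mdp"
  shows "hit_prob M s \<sigma> t = measure_pmf.prob (play_law M s \<sigma> t) {l. avoid M \<in> fst ` set l}"
proof -
  have g: "(\<lambda>\<omega>. map \<omega> [0..<t]) \<in> measurable (play_measure M s \<sigma>) (count_space UNIV)"
  proof -
    have "(\<lambda>\<omega>. restrict \<omega> {0..<t}) \<in> measurable (play_measure M s \<sigma>)
        (PiM {0..<t} (\<lambda>_. count_space UNIV))"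
      by (auto simp: measurable_cong_sets[OF sets_play_measure refl] intro!: measurable_restrict_subset)
    moreover have "(\<lambda>\<omega>. map \<omega> [0..<t]) \<in>
        measurable (PiM {0..<t} (\<lambda>_. count_space (UNIV :: ('s \<times> 'a) set))) (count_space UNIV)"
      by (subst count_space_PiM_finite) auto
    ultimately have "(\<lambda>\<omega>. map (restrict \<omega> {0..<t}) [0..<t])
        \<in> measurable (play_measure M s \<sigma>) (count_space UNIV)"
      by (rule measurable_compose)
    also have "(\<lambda>\<omega>. map (restrict \<omega> {0..<t}) [0..<t]) = (\<lambda>\<omega>. map \<omega> [0..<t])"
      by auto
    finally show ?thesis .
  qed
  have "measure_pmf.prob (play_law M s \<sigma> t) {l. avoid M \<in> fst ` set l} =
      measure (play_measure M s \<sigma>)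
        ((\<lambda>\<omega>. map \<omega> [0..<t]) -` {l. avoid M \<in> fst ` set l} \<inter> space (play_measure M s \<sigma>))"
    by (simp add: distr_play_measure_prefix[symmetric] measure_distr[OF g])
  also have "\<dots> = hit_prob M s \<sigma> t"
    unfolding hit_prob_def
    by (rule arg_cong[where f = "measure _"]) (force simp: hit_time_le_iff image_iff)
  finally show ?thesis by simp
qed

lemma play_law_length: "l \<in> set_pmf (play_law M s \<sigma> n) \<Longrightarrow> length l = n"
  by (induction n arbitrary: l) (auto simp: play_law.simps(2))

section \<open>Conditioning on the first step\<close>

text \<open>\<open>play_law\<close> grows at the end; this is the recursion at the front. Dropping
  the first pair leaves the law of the next appended pair unchanged.\<close>

lemma play_law_first_step:
  "play_law M s \<sigma> (Suc n) = bind_pmf (\<sigma> ([], s)) (\<lambda>a. bind_pmf (next_state M s a)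
     (\<lambda>y. map_pmf ((#) (s, a)) (play_law M y (shift_strategy \<sigma> s a) n)))"
proof (induction n)
  case 0
  show ?case
    by (simp add: play_law.simps(2) step_law_def bind_return_pmf map_pmf_def bind_assoc_pmf)
next
  case (Suc n)
  show ?case
  \<comment> \<open>For \<open>n = 0\<close> the fact \<open>*\<close> below fails:
    \<open>step_law\<close> at \<open>[(s, a)]\<close> draws a new state, whereas the continuation
    at \<open>[]\<close> starts in the given \<open>y\<close>. Only after averaging over
    \<open>y\<close> do the two sides agree.\<close>
  proof (cases n)
    case 0
    then show ?thesis
      unfolding Suc
      by (simp add: play_law.simps(2) step_law_def shift_strategy_def bind_return_pmf map_pmf_def bind_assoc_pmf)
  next
    case (Suc k)
    have *: "step_law M s \<sigma> ((s, a) # l) = step_law M y (shift_strategy \<sigma> s a) l"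
      if "l \<in> set_pmf (play_law M y (shift_strategy \<sigma> s a) n)" for a y l
      using play_law_length[OF that] Suc by (auto simp: step_law_def shift_strategy_def)
    have "play_law M s \<sigma> (Suc (Suc n)) =
        bind_pmf (\<sigma> ([], s)) (\<lambda>a. bind_pmf (next_state M s a)
          (\<lambda>y. bind_pmf (play_law M y (shift_strategy \<sigma> s a) n)
            (\<lambda>l. map_pmf (\<lambda>x. ((s, a) # l) @ [x]) (step_law M s \<sigma> ((s, a) # l)))))"
      unfolding play_law.simps(2)[of M s \<sigma> "Suc n"] Suc.IH
      by (simp add: bind_assoc_pmf bind_map_pmf)
    also have "\<dots> = bind_pmf (\<sigma> ([], s)) (\<lambda>a. bind_pmf (next_state M s a)
          (\<lambda>y. bind_pmf (play_law M y (shift_strategy \<sigma> s a) n)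
            (\<lambda>l. map_pmf (\<lambda>x. ((s, a) # l) @ [x]) (step_law M y (shift_strategy \<sigma> s a) l))))"
      by (intro bind_pmf_cong refl) (simp add: *)
    finally show ?thesis
      by (simp add: play_law.simps(2) map_bind_pmf map_pmf_comp)
  qed
qed

text \<open>A play from \<open>s\<close> meets only histories that start in \<open>s\<close>.
  Strategies may therefore be altered at all others, as \<open>continuation\<close> does.\<close>

lemma play_law_cong:
  assumes "\<And>h. state_at h 0 = s \<Longrightarrow> \<sigma> h = \<tau> h"
  shows "play_law M s \<sigma> n = play_law M s \<tau> n"
proof (cases n)
  case (Suc k)
  have "shift_strategy \<sigma> s = shift_strategy \<tau> s"
    by (auto simp: shift_strategy_def fun_eq_iff state_at_def intro!: assms)
  moreover have "\<sigma> ([], s) = \<tau> ([], s)"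
    by (simp add: assms state_at_def)
  ultimately show ?thesis
    unfolding Suc play_law_first_step by simp
qed simp

lemma hit_prob_0: "hit_prob M s \<sigma> 0 = 0"
  by (simp add: hit_prob_eq_play_law)

text \<open>Since \<open>s\<close> is not \<open>avoid M\<close>, the first pair is no hit, and the
  remaining \<open>t\<close> periods form a play from the second state.\<close>

lemma hit_prob_Suc:
  fixes M :: "('s::finite, 'a::finite) safety_mdp"
  assumes "s \<noteq> avoid M"
  shows "hit_prob M s \<sigma> (Suc t) =
    (\<Sum>a\<in>UNIV. \<Sum>y\<in>UNIV. pmf (\<sigma> ([], s)) a * pmf (next_state M s a) y *
       hit_prob M y (shift_strategy \<sigma> s a) t)"
proof -
  have bind: "measure_pmf.prob (bind_pmf p f) A = (\<Sum>x\<in>UNIV. pmf p x * measure_pmf.prob (f x) A)"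
    for p :: "'c::finite pmf" and f :: "'c \<Rightarrow> 'd pmf" and A
  proof -
    \<comment> \<open>Viewing the event as a Boolean-valued image reduces the law of total
      probability to \<open>pmf_bind\<close>.\<close>
    have prob: "measure_pmf.prob q A = pmf (map_pmf (\<lambda>x. x \<in> A) q) True" for q :: "'d pmf"
      by (simp add: pmf_map vimage_def)
    show ?thesis
      by (simp add: prob map_bind_pmf pmf_bind integral_measure_pmf_real[of UNIV] mult.commute)
  qed
  have "((#) (s, a)) -` {l. avoid M \<in> fst ` set l} = {l. avoid M \<in> fst ` set l}" for a
    using assms by auto
  then show ?thesis
    unfolding hit_prob_eq_play_law play_law_first_step
    using assms[symmetric] by (simp add: bind sum_distrib_left mult.assoc)
qed

text \<open>The value is independent of the strategy, which covers plays that reach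
  \<open>avoid M\<close>, where no overtaking strategy is given. It is 0 at \<open>t = 0\<close>
  because periods start at 1.\<close>

lemma hit_prob_avoid:
  fixes M :: "('s::finite, 'a::finite) safety_mdp"
  shows "hit_prob M (avoid M) \<sigma> t = (if t = 0 then 0 else 1)"
proof (cases t)
  case (Suc k)
  have "measure_pmf.prob (play_law M (avoid M) \<sigma> (Suc k)) {l. avoid M \<in> fst ` set l} = 1"
    by (subst measure_pmf.prob_eq_1) (auto simp: AE_measure_pmf_iff play_law_first_step)
  then show ?thesis
    by (simp add: Suc hit_prob_eq_play_law)
qed (simp add: hit_prob_0)

lemma play_law_1: "play_law M s \<sigma> (Suc 0) = map_pmf (\<lambda>a. [(s, a)]) (\<sigma> ([], s))"
  by (simp add: play_law_first_step map_pmf_def bind_return_pmf)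

lemma play_law_head:
  "l \<in> set_pmf (play_law M s \<sigma> n) \<Longrightarrow> l \<noteq> [] \<Longrightarrow> fst (hd l) = s"
  by (cases n) (auto simp: play_law_first_step)

text \<open>A nonempty \<open>l\<close> reveals the second state, so a single action and a single
  state survive in the first-step decomposition.\<close>

lemma pmf_play_law_Cons:
  fixes M :: "('s::finite, 'a::finite) safety_mdp"
  assumes "l \<noteq> []"
  shows "pmf (play_law M s \<sigma> (Suc n)) ((s, a) # l) =
    pmf (\<sigma> ([], s)) a * pmf (next_state M s a) (fst (hd l)) *
    pmf (play_law M (fst (hd l)) (shift_strategy \<sigma> s a) n) l"
proof -
  let ?q = "\<lambda>a. bind_pmf (next_state M s a) (\<lambda>y. map_pmf ((#) (s, a)) (play_law M y (shift_strategy \<sigma> s a) n))"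
  have *: "pmf (?q b) ((s, a) # l) = 0" if "b \<noteq> a" for b
    using that by (auto simp: pmf_eq_0_set_pmf)
  have "pmf (play_law M s \<sigma> (Suc n)) ((s, a) # l) = pmf (\<sigma> ([], s)) a * pmf (?q a) ((s, a) # l)"
    unfolding play_law_first_step
    by (subst pmf_bind, subst integral_measure_pmf_real[of "{a}"]) (use * in \<open>auto simp: mult.commute\<close>)
  also have "pmf (?q a) ((s, a) # l) = pmf (next_state M s a) (fst (hd l)) *
      pmf (play_law M (fst (hd l)) (shift_strategy \<sigma> s a) n) l"
  proof -
    have "pmf (map_pmf ((#) (s, a)) (play_law M y (shift_strategy \<sigma> s a) n)) ((s, a) # l) =
        pmf (play_law M y (shift_strategy \<sigma> s a) n) l" for y
      by (rule pmf_map_inj') auto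
    moreover have "pmf (play_law M y (shift_strategy \<sigma> s a) n) l = 0" if "y \<noteq> fst (hd l)" for y
      using that assms by (auto simp: pmf_eq_0_set_pmf dest: play_law_head)
    ultimately show ?thesis
      by (subst pmf_bind, subst integral_measure_pmf_real[of "{fst (hd l)}"]) (auto simp: mult.commute)
  qed
  finally show ?thesis by simp
qed

section \<open>Continuing and splicing strategies\<close>

lemma state_at_Cons: "state_at (q # l, x) (Suc i) = state_at (l, x) i"
  by (simp add: state_at_def)

lemma is_history_Nil: "is_history M ([], s) \<longleftrightarrow> s \<noteq> avoid M"
  by (simp add: is_history_def state_at_def)

text \<open>Only the first state of a history must differ from \<open>avoid M\<close>; the
  assumption demands this of the second state too, so that the tail can be a history itself.\<close>

lemma is_history_Cons:
  assumes "state_at (l, x) 0 \<noteq> avoid M"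
  shows "is_history M ((s, a) # l, x) \<longleftrightarrow> s \<noteq> avoid M \<and> a \<in> acts M s \<and>
    pmf (next_state M s a) (state_at (l, x) 0) > 0 \<and> is_history M (l, x)"
  using assms
  by (auto simp: is_history_def state_at_Cons All_less_Suc2) (auto simp: state_at_def)

text \<open>Outside the histories that start in \<open>y\<close>, \<open>shift_strategy \<sigma> s a\<close> may use actions that are not
  available; there the continuation falls back on \<open>\<sigma>\<close>.\<close>

definition continuation where
  "continuation \<sigma> s a y = (\<lambda>h. if state_at h 0 = y then shift_strategy \<sigma> s a h else \<sigma> h)"

text \<open>\<open>splice_at \<sigma> \<tau> s a y\<close> follows \<open>\<sigma>\<close> but restarts with \<open>\<tau>\<close> at \<open>y\<close> if the play begins with \<open>s, a, y\<close>.\<close>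

definition splice_at where
  "splice_at \<sigma> \<tau> s a y = (\<lambda>(l, x). case l of [] \<Rightarrow> \<sigma> (l, x)
     | q # l' \<Rightarrow> if q = (s, a) \<and> state_at (l', x) 0 = y then \<tau> (l', x) else \<sigma> (l, x))"

text \<open>As \<open>a\<close> and \<open>y\<close> have positive probability, prefixing
  \<open>(s, a)\<close> to a history that starts in \<open>y\<close> gives a history, where
  \<open>\<sigma>\<close> uses available actions.\<close>

lemma is_strategy_continuation:
  assumes "is_strategy M \<sigma>" "s \<noteq> avoid M" "y \<noteq> avoid M"
    and "a \<in> set_pmf (\<sigma> ([], s))" "y \<in> set_pmf (next_state M s a)"
  shows "is_strategy M (continuation \<sigma> s a y)"
  unfolding is_strategy_def
proof (intro allI impI)
  fix h assume h: "is_history M h"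
  obtain l x where lx: "h = (l, x)" by force
  have "a \<in> acts M s"
    using assms is_history_Nil[of M s] unfolding is_strategy_def by force
  then have ext: "is_history M ((s, a) # l, x)" if "state_at (l, x) 0 = y"
    using that assms h lx by (subst is_history_Cons) (auto simp: pmf_positive)
  have acts: "set_pmf (\<sigma> k) \<subseteq> acts M (snd k)" if "is_history M k" for k
    using assms(1) that unfolding is_strategy_def by blast
  show "set_pmf (continuation \<sigma> s a y h) \<subseteq> acts M (snd h)"
    using acts[OF ext] acts[OF h] unfolding lx continuation_def shift_strategy_def by simp
qed

lemma is_strategy_splice_at:
  assumes "is_strategy M \<sigma>" "is_strategy M \<tau>" "y \<noteq> avoid M"
  shows "is_strategy M (splice_at \<sigma> \<tau> s a y)"
  unfolding is_strategy_def
proof (intro allI impI)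
  fix h assume h: "is_history M h"
  obtain l x where lx: "h = (l, x)" by force
  have rest: "is_history M (l', x)" if "l = (s, a) # l'" "state_at (l', x) 0 = y" for l'
    using that assms(3) h lx by (simp add: is_history_Cons)
  have acts: "set_pmf (\<rho> k) \<subseteq> acts M (snd k)" if "is_strategy M \<rho>" "is_history M k" for \<rho> k
    using that unfolding is_strategy_def by blast
  show "set_pmf (splice_at \<sigma> \<tau> s a y h) \<subseteq> acts M (snd h)"
    using acts[OF assms(1) h] acts[OF assms(2) rest]
    unfolding lx splice_at_def by (auto split: list.split)
qed

lemma splice_at_Nil: "splice_at \<sigma> \<tau> s a y ([], x) = \<sigma> ([], x)"
  by (simp add: splice_at_def)

lemma shift_splice_at:
  "shift_strategy (splice_at \<sigma> \<tau> s a y) s b h =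
     (if b = a \<and> state_at h 0 = y then \<tau> h else shift_strategy \<sigma> s b h)"
  by (cases h) (auto simp: shift_strategy_def splice_at_def)

lemma play_law_splice_at:
  "play_law M z (shift_strategy (splice_at \<sigma> \<tau> s a y) s b) n =
     (if b = a \<and> z = y then play_law M y \<tau> n else play_law M z (shift_strategy \<sigma> s b) n)"
  by (auto intro!: play_law_cong simp: shift_splice_at)

lemma play_law_continuation:
  "play_law M y (continuation \<sigma> s a y) n = play_law M y (shift_strategy \<sigma> s a) n"
  by (auto intro!: play_law_cong simp: continuation_def)

lemma hit_prob_continuation:
  fixes M :: "('s::finite, 'a::finite) safety_mdp"
  shows "hit_prob M y (continuation \<sigma> s a y) t = hit_prob M y (shift_strategy \<sigma> s a) t"
  by (simp add: hit_prob_eq_play_law play_law_continuation)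

text \<open>In the first-step expansions of both terms all summands cancel except the one for
  \<open>a\<close> and \<open>y\<close>.\<close>

lemma hit_prob_diff_splice_at:
  fixes M :: "('s::finite, 'a::finite) safety_mdp"
  assumes "s \<noteq> avoid M"
  shows "hit_prob M s \<sigma> (Suc t) - hit_prob M s (splice_at \<sigma> \<tau> s a y) (Suc t) =
    pmf (\<sigma> ([], s)) a * pmf (next_state M s a) y *
      (hit_prob M y (continuation \<sigma> s a y) t - hit_prob M y \<tau> t)"
    (is "_ = ?D")
proof -
  have *: "hit_prob M z (shift_strategy (splice_at \<sigma> \<tau> s a y) s b) t =
      (if b = a \<and> z = y then hit_prob M y \<tau> t else hit_prob M z (shift_strategy \<sigma> s b) t)" for z b
    by (simp add: hit_prob_eq_play_law play_law_splice_at)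
  have "hit_prob M s \<sigma> (Suc t) - hit_prob M s (splice_at \<sigma> \<tau> s a y) (Suc t) =
      (\<Sum>b\<in>UNIV. \<Sum>z\<in>UNIV. if b = a then if z = y then ?D else 0 else 0)"
    unfolding hit_prob_Suc[OF assms] sum_subtractf[symmetric] splice_at_Nil *
    by (intro sum.cong refl) (auto simp: hit_prob_continuation algebra_simps)
  also have "\<dots> = (\<Sum>b\<in>UNIV. if b = a then ?D else 0)"
    by (intro sum.cong refl) auto
  finally show ?thesis by simp
qed

section \<open>Overtaking: uniqueness and inheritance by continuations\<close>

text \<open>Comparing laws of finite prefixes instead of \<^const>\<open>play_measure\<close> avoids having to show that
  these laws determine the measure.\<close>

definition overtakes_all_other_laws ::
    "('s::finite, 'a::finite) safety_mdp \<Rightarrow> 's \<Rightarrow> (('s, 'a) hist \<Rightarrow> 'a pmf) \<Rightarrow> bool" where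
  "overtakes_all_other_laws M s \<sigma> \<longleftrightarrow> is_strategy M \<sigma> \<and>
     (\<forall>\<tau> n. is_strategy M \<tau> \<longrightarrow> play_law M s \<tau> n \<noteq> play_law M s \<sigma> n \<longrightarrow>
        weakly_overtakes M s \<sigma> \<tau>)"

lemma overtakes_all_other_lawsI:
  assumes "is_strategy M \<sigma>" "weakly_overtakes_all_others M s \<sigma>"
  shows "overtakes_all_other_laws M s \<sigma>"
  using assms play_law_eqI
  unfolding overtakes_all_other_laws_def weakly_overtakes_all_others_def by blast

lemma weakly_overtakes_asym:
  assumes "weakly_overtakes M s \<sigma> \<tau>"
  shows "\<not> weakly_overtakes M s \<tau> \<sigma>"
proof
  assume "weakly_overtakes M s \<tau> \<sigma>"
  then obtain T where "\<forall>t\<ge>T. hit_prob M s \<tau> t \<le> hit_prob M s \<sigma> t"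
    unfolding weakly_overtakes_def by blast
  then have "{t. hit_prob M s \<sigma> t < hit_prob M s \<tau> t} \<subseteq> {..<T}"
    by (auto simp: not_le[symmetric])
  then show False
    using assms finite_subset unfolding weakly_overtakes_def by blast
qed

text \<open>If the laws differed for some \<open>n\<close>, each strategy would weakly overtake the
  other.\<close>

lemma overtakes_all_other_laws_unique:
  assumes "overtakes_all_other_laws M s \<sigma>" "overtakes_all_other_laws M s \<tau>"
  shows "play_law M s \<sigma> n = play_law M s \<tau> n"
  using assms weakly_overtakes_asym unfolding overtakes_all_other_laws_def by metis

text \<open>The two differences of hitting probabilities have the same sign, one period apart,
  because the factor \<open>?c\<close> is positive.\<close>

lemma weakly_overtakes_continuation:
  fixes M :: "('s::finite, 'a::finite) safety_mdp"
  assumes "weakly_overtakes M s \<sigma> (splice_at \<sigma> \<tau> s a y)" "s \<noteq> avoid M"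
    and "a \<in> set_pmf (\<sigma> ([], s))" "y \<in> set_pmf (next_state M s a)"
  shows "weakly_overtakes M y (continuation \<sigma> s a y) \<tau>"
proof -
  let ?c = "pmf (\<sigma> ([], s)) a * pmf (next_state M s a) y"
  have c: "?c > 0"
    using assms(3,4) by (simp add: pmf_positive)
  have diff: "hit_prob M s \<sigma> (Suc t) - hit_prob M s (splice_at \<sigma> \<tau> s a y) (Suc t) =
      ?c * (hit_prob M y (continuation \<sigma> s a y) t - hit_prob M y \<tau> t)" for t
    by (rule hit_prob_diff_splice_at[OF assms(2)])
  have le: "hit_prob M s \<sigma> (Suc t) \<le> hit_prob M s (splice_at \<sigma> \<tau> s a y) (Suc t) \<longleftrightarrow>
      hit_prob M y (continuation \<sigma> s a y) t \<le> hit_prob M y \<tau> t" for t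
    using diff[of t] c by (smt (verit) mult_le_0_iff)
  have less: "hit_prob M s \<sigma> (Suc t) < hit_prob M s (splice_at \<sigma> \<tau> s a y) (Suc t) \<longleftrightarrow>
      hit_prob M y (continuation \<sigma> s a y) t < hit_prob M y \<tau> t" for t
    using diff[of t] c by (smt (verit) mult_less_0_iff)
  obtain T where "\<forall>t\<ge>T. hit_prob M s \<sigma> t \<le> hit_prob M s (splice_at \<sigma> \<tau> s a y) t"
    using assms(1) unfolding weakly_overtakes_def by blast
  then have "\<forall>t\<ge>T. hit_prob M y (continuation \<sigma> s a y) t \<le> hit_prob M y \<tau> t"
    by (simp add: le[symmetric])
  moreover have "infinite {t. hit_prob M y (continuation \<sigma> s a y) t < hit_prob M y \<tau> t}" (is "infinite ?A")
  proof
    assume "finite ?A"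
    \<comment> \<open>The shift by one period leaves out \<open>t = 0\<close>; one extra element
      does not affect finiteness.\<close>
    moreover have "{t. hit_prob M s \<sigma> t < hit_prob M s (splice_at \<sigma> \<tau> s a y) t} \<subseteq> insert 0 (Suc ` ?A)"
    proof
      fix t assume "t \<in> {t. hit_prob M s \<sigma> t < hit_prob M s (splice_at \<sigma> \<tau> s a y) t}"
      then show "t \<in> insert 0 (Suc ` ?A)"
        by (cases t) (auto simp: less)
    qed
    ultimately show False
      using assms(1) finite_subset unfolding weakly_overtakes_def by blast
  qed
  ultimately show ?thesis
    unfolding weakly_overtakes_def by blast
qed

text \<open>A rival \<open>\<tau>\<close> with a different law at \<open>y\<close> yields a spliced
  rival with a different law at \<open>s\<close>. As \<open>\<sigma>\<close> overtakes the latter,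
  its continuation overtakes \<open>\<tau>\<close>.\<close>

lemma overtakes_all_other_laws_continuation:
  fixes M :: "('s::finite, 'a::finite) safety_mdp"
  assumes opt: "overtakes_all_other_laws M s \<sigma>" and s: "s \<noteq> avoid M" and y: "y \<noteq> avoid M"
    and a: "a \<in> set_pmf (\<sigma> ([], s))" and sy: "y \<in> set_pmf (next_state M s a)"
  shows "overtakes_all_other_laws M y (continuation \<sigma> s a y)"
  unfolding overtakes_all_other_laws_def
proof (intro conjI allI impI)
  have \<sigma>: "is_strategy M \<sigma>"
    using opt unfolding overtakes_all_other_laws_def by blast
  show "is_strategy M (continuation \<sigma> s a y)"
    by (rule is_strategy_continuation[OF \<sigma> s y a sy])
  fix \<tau> n assume \<tau>: "is_strategy M \<tau>"
    and "play_law M y \<tau> n \<noteq> play_law M y (continuation \<sigma> s a y) n"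
  then obtain l where l: "pmf (play_law M y \<tau> n) l \<noteq> pmf (play_law M y (shift_strategy \<sigma> s a) n) l"
    unfolding play_law_continuation by (meson pmf_eqI)
  \<comment> \<open>Two different probabilities are not both 0, so \<open>\<rho>\<close> can be
    \<open>\<tau>\<close> or the shifted strategy. Either way \<open>l\<close> has length
    \<open>n\<close> and starts in \<open>y\<close>.\<close>
  then obtain \<rho> where l\<rho>: "l \<in> set_pmf (play_law M y \<rho> n)"
    by (metis pmf_eq_0_set_pmf)
  have "n \<noteq> 0"
    using l by (intro notI) simp
  then have ne: "l \<noteq> []"
    using play_law_length[OF l\<rho>] by auto
  then have hd: "fst (hd l) = y"
    using play_law_head[OF l\<rho>] by simp
  \<comment> \<open>Prefixing \<open>(s, a)\<close> multiplies both probabilities of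
    \<open>l\<close> by the same positive factor.\<close>
  have "pmf (play_law M s (splice_at \<sigma> \<tau> s a y) (Suc n)) ((s, a) # l) \<noteq>
      pmf (play_law M s \<sigma> (Suc n)) ((s, a) # l)"
    using l a sy
    by (simp add: pmf_play_law_Cons[OF ne] hd splice_at_Nil play_law_splice_at set_pmf_iff)
  then have "weakly_overtakes M s \<sigma> (splice_at \<sigma> \<tau> s a y)"
    using opt is_strategy_splice_at[OF \<sigma> \<tau> y] unfolding overtakes_all_other_laws_def by metis
  then show "weakly_overtakes M y (continuation \<sigma> s a y) \<tau>"
    using s a sy by (rule weakly_overtakes_continuation)
qed

section \<open>The stationary strategy\<close>

text \<open>The induction ranges over every \<open>\<sigma>\<close> that overtakes all other laws,
  not just \<open>\<Sigma> s\<close>, because it is applied to continuations of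
  \<open>\<sigma>\<close>.\<close>

lemma hit_prob_eq_stationary:
  fixes M :: "('s::finite, 'a::finite) safety_mdp"
  assumes opt: "\<And>s. s \<noteq> avoid M \<Longrightarrow> overtakes_all_other_laws M s (\<Sigma> s)"
    and d: "\<And>s. s \<noteq> avoid M \<Longrightarrow> d s = \<Sigma> s ([], s)"
    and "s \<noteq> avoid M" "overtakes_all_other_laws M s \<sigma>"
  shows "hit_prob M s \<sigma> t = hit_prob M s (\<lambda>h. d (snd h)) t"
  using assms(3,4)
proof (induction t arbitrary: s \<sigma>)
  case 0
  show ?case
    by (simp add: hit_prob_0)
next
  case (Suc t)
  have "play_law M s \<sigma> (Suc 0) = play_law M s (\<Sigma> s) (Suc 0)"
    by (rule overtakes_all_other_laws_unique[OF Suc.prems(2) opt[OF Suc.prems(1)]])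
  \<comment> \<open>The first move is read off the law of the first pair.\<close>
  then have "map_pmf (snd \<circ> hd) (play_law M s \<sigma> (Suc 0)) =
      map_pmf (snd \<circ> hd) (play_law M s (\<Sigma> s) (Suc 0))"
    by simp
  then have first: "\<sigma> ([], s) = d s"
    using d[OF Suc.prems(1)] by (simp add: play_law_1 map_pmf_comp)
  have shift_d: "shift_strategy (\<lambda>h. d (snd h)) s a = (\<lambda>h. d (snd h))" for a
    by (auto simp: shift_strategy_def)
  have "hit_prob M y (shift_strategy \<sigma> s a) t = hit_prob M y (\<lambda>h. d (snd h)) t"
    if "a \<in> set_pmf (\<sigma> ([], s))" "y \<in> set_pmf (next_state M s a)" for a y
  proof (cases "y = avoid M")
    case True
    then show ?thesis
      by (simp add: hit_prob_avoid)
  next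
    case False
    then show ?thesis
      using Suc.IH[OF False overtakes_all_other_laws_continuation[OF Suc.prems(2,1) False that]]
      by (simp add: hit_prob_continuation)
  qed
  \<comment> \<open>Outside the supports both sides are 0, whatever the hitting probabilities
    are.\<close>
  then have summand: "pmf (d s) a * pmf (next_state M s a) y * hit_prob M y (shift_strategy \<sigma> s a) t =
      pmf (d s) a * pmf (next_state M s a) y * hit_prob M y (\<lambda>h. d (snd h)) t" for a y
    unfolding first by (metis mult_zero_left mult_zero_right pmf_eq_0_set_pmf)
  then show ?case
    unfolding hit_prob_Suc[OF Suc.prems(1)] shift_d first by (simp only: summand snd_conv)
qed

theorem mainTheorem6:
  fixes M :: "('s::finite, 'a::finite) safety_mdp"
  assumes "is_safety_mdp M"
    and "\<And>s. s \<noteq> avoid M \<Longrightarrow>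
      \<exists>\<sigma>. is_strategy M \<sigma> \<and> weakly_overtakes_all_others M s \<sigma>"
  shows "\<exists>\<sigma>. is_strategy M \<sigma> \<and> stationary M \<sigma> \<and>
    (\<forall>s. s \<noteq> avoid M \<longrightarrow> strongly_overtaking_optimal M s \<sigma>)"
proof -
  obtain \<Sigma> where opt: "\<And>s. s \<noteq> avoid M \<Longrightarrow> overtakes_all_other_laws M s (\<Sigma> s)"
    using assms(2) overtakes_all_other_lawsI by metis
  \<comment> \<open>Histories may pass through \<open>avoid M\<close> after period 1, so an
    available action is chosen there too, although no \<open>\<Sigma> s\<close> is given.\<close>
  define d where "d s = (if s = avoid M then return_pmf (SOME a. a \<in> acts M s) else \<Sigma> s ([], s))" for s
  let ?f = "\<lambda>h :: ('s, 'a) hist. d (snd h)"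
  have d_acts: "set_pmf (d s) \<subseteq> acts M s" for s
  proof (cases "s = avoid M")
    case True
    have "acts M s \<noteq> {}"
      using assms(1) unfolding is_safety_mdp_def by blast
    then show ?thesis
      using True by (simp add: d_def some_in_eq)
  next
    case False
    then show ?thesis
      using opt[OF False] is_history_Nil[of M s]
      unfolding overtakes_all_other_laws_def is_strategy_def d_def by fastforce
  qed
  have hit: "hit_prob M s ?f t = hit_prob M s (\<Sigma> s) t" if "s \<noteq> avoid M" for s t
    using hit_prob_eq_stationary[of M \<Sigma> d, OF opt _ that opt[OF that]] by (simp add: d_def)
  have "strongly_overtaking_optimal M s ?f" if s: "s \<noteq> avoid M" for s
    unfolding strongly_overtaking_optimal_def
  proof safe
    fix \<tau> assume \<tau>: "is_strategy M \<tau>" "weakly_overtakes M s \<tau> ?f"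
    then have over: "weakly_overtakes M s \<tau> (\<Sigma> s)"
      unfolding weakly_overtakes_def by (simp add: hit[OF s])
    \<comment> \<open>Equal laws would give equal hitting probabilities, contradicting the strict
      inequalities in \<open>over\<close>. Once the laws differ, \<open>\<Sigma> s\<close> overtakes
      \<open>\<tau>\<close> in turn.\<close>
    have "\<exists>n. play_law M s \<tau> n \<noteq> play_law M s (\<Sigma> s) n"
    proof (rule ccontr)
      assume "\<not> ?thesis"
      then have "hit_prob M s \<tau> t = hit_prob M s (\<Sigma> s) t" for t
        by (simp add: hit_prob_eq_play_law)
      then show False
        using over unfolding weakly_overtakes_def by simp
    qed
    then have "weakly_overtakes M s (\<Sigma> s) \<tau>"
      using opt[OF s] \<tau>(1) unfolding overtakes_all_other_laws_def by blast
    then show False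
      using over weakly_overtakes_asym by blast
  qed
  then show ?thesis
    using d_acts unfolding is_strategy_def stationary_def by (intro exI[of _ ?f]) auto
qed

end
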